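(* Let $(W,d)$ be a closed Hilbert complex, let $k$ be a degree with $b_k:=\dim\mathfrak H^k<\infty$, and let $J\in\mathfrak Z^*_k=\ker d^*_k$. Define $$\boldsymbol\Pi_J(v):=\langle v,J\rangle_{W^k},\qquad v\in W^k .$$ Then: (i) $\boldsymbol\Pi_J$ vanishes on $\mathfrak B^k$ and therefore descends to a linear functional on $\mathfrak Z^k/\mathfrak B^k$. (ii) For every $v\in\mathfrak Z^k$, $$\boldsymbol\Pi_J(v)=\langle P_{\mathfrak H}v,P_{\mathfrak H}J\rangle_{W^k},$$ so $\boldsymbol\Pi_J$ (as a functional on $\mathfrak Z^k$) depends on $J$ only through $P_{\mathfrak H}J$. (iii) Conversely, every linear functional on $\mathfrak H^k$ is of the form $v\mapsto\langle v,J\rangle_{W^k}$ for some $J\in\mathfrak Z^*_k$. (iv) Given $J_1,\dots,J_{b_k}\in\mathfrak Z^*_k$, the induced map $$\boldsymbol\Pi=(\boldsymbol\Pi_{J_1},\dots,\boldsymbol\Pi_{J_{b_k}}):\mathfrak H^k\to\mathbb R^{b_k}$$ is an isomorphism if and only if $P_{\mathfrak H}J_1,\dots,P_{\mathfrak H}J_{b_k}$ are linearly independent.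
   Context: A Hilbert complex $(W,d)$ consists of real Hilbert spaces $W^k$ and densely defined closed linear operators $d^k:V^k\subset W^k\to W^{k+1}$ with domains $V^k$, such that $d^k$ maps $V^k$ into $V^{k+1}$ and $d^{k+1}d^k=0$. Put $\mathfrak Z^k:=\ker d^k$ and $\mathfrak B^k:=\operatorname{range} d^{k-1}\subset\mathfrak Z^k$. The complex is closed if every $\mathfrak B^k$ is closed in $W^k$. The operator $d^*_k:V^*_k\subset W^k\to W^{k-1}$ is the Hilbert space adjoint of $d^{k-1}$, i.e. $\langle d^*_ku,v\rangle_{W^{k-1}}=\langle u,d^{k-1}v\rangle_{W^k}$ for all $v\in V^{k-1}$. Put $\mathfrak Z^*_k:=\ker d^*_k$. The space of harmonic forms is $\mathfrak H^k:=\mathfrak Z^k\cap\mathfrak Z^*_k$, and $P_{\mathfrak H}:W^k\to\mathfrak H^k$ is the $W^k$-orthogonal projection. *)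

theory Defs
  imports "HOL-Analysis.Analysis"
begin

text \<open>
  Linearity of a map that is only considered on a subspace \<open>S\<close>; the library predicate
  \<open>linear\<close> is about maps defined on a whole type.
\<close>

definition linear_map_on :: "'a::real_vector set \<Rightarrow> ('a \<Rightarrow> 'b::real_vector) \<Rightarrow> bool" where
  "linear_map_on S f \<longleftrightarrow>
     (\<forall>x\<in>S. \<forall>y\<in>S. f (x + y) = f x + f y) \<and> (\<forall>c. \<forall>x\<in>S. f (c *\<^sub>R x) = c *\<^sub>R f x)"

text \<open>
  The Hilbert spaces \<open>W k\<close> are complete subspaces of one real inner product space.
  This is no loss of generality, since an arbitrary family of Hilbert spaces embeds
  isometrically in its Hilbert direct sum, and it does not relate the different
  \<open>W k\<close> to each other.  Degrees are integers; a complex indexed by naturals, or a finite one,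
  is extended by zero spaces.  Values of \<open>d k\<close> outside its domain \<open>V k\<close> are irrelevant.
\<close>

locale hilbert_complex =
  fixes W V :: "int \<Rightarrow> 'a::real_inner set"
    and d :: "int \<Rightarrow> 'a \<Rightarrow> 'a"
  assumes subspace_W: "subspace (W k)"
    and complete_W: "complete (W k)"
    and subspace_V: "subspace (V k)"
    and dense_V: "closure (V k) = W k"
    and linear_d: "linear_map_on (V k) (d k)"
    and d_maps: "v \<in> V k \<Longrightarrow> d k v \<in> V (k + 1)"
    and d_d: "v \<in> V k \<Longrightarrow> d (k + 1) (d k v) = 0"
    and closed_graph_d: "closed {(v, d k v) | v. v \<in> V k}"

definition cocycles :: "(int \<Rightarrow> 'a::real_inner set) \<Rightarrow> (int \<Rightarrow> 'a \<Rightarrow> 'a) \<Rightarrow> int \<Rightarrow> 'a set" where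
  "cocycles V d k = {v \<in> V k. d k v = 0}"

definition coboundaries :: "(int \<Rightarrow> 'a::real_inner set) \<Rightarrow> (int \<Rightarrow> 'a \<Rightarrow> 'a) \<Rightarrow> int \<Rightarrow> 'a set" where
  "coboundaries V d k = d (k - 1) ` V (k - 1)"

locale closed_hilbert_complex = hilbert_complex +
  assumes closed_coboundaries: "closed (coboundaries V d k)"

text \<open>
  The Hilbert space adjoint of a densely defined operator \<open>T\<close> with domain \<open>D \<subseteq> X\<close> and values
  in \<open>Y\<close>: its domain is the set of all \<open>u \<in> Y\<close> for which \<open>v \<mapsto> u \<bullet> T v\<close> is represented on \<open>D\<close> by
  an element of \<open>X\<close>, which is unique by density of \<open>D\<close> and is the value of the adjoint at \<open>u\<close>.
\<close>

definition adjoint_domain ::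
    "'a::real_inner set \<Rightarrow> 'a set \<Rightarrow> ('a \<Rightarrow> 'b::real_inner) \<Rightarrow> 'b set \<Rightarrow> 'b set" where
  "adjoint_domain X D T Y = {u \<in> Y. \<exists>w\<in>X. \<forall>v\<in>D. w \<bullet> v = u \<bullet> T v}"

definition adjoint_operator ::
    "'a::real_inner set \<Rightarrow> 'a set \<Rightarrow> ('a \<Rightarrow> 'b::real_inner) \<Rightarrow> 'b \<Rightarrow> 'a" where
  "adjoint_operator X D T u = (THE w. w \<in> X \<and> (\<forall>v\<in>D. w \<bullet> v = u \<bullet> T v))"

lemma adjoint_operator_eqI:
  assumes X: "subspace X" and dense: "closure D = X"
    and w: "w \<in> X" "\<And>v. v \<in> D \<Longrightarrow> w \<bullet> v = u \<bullet> T v"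
  shows "adjoint_operator X D T u = w"
  unfolding adjoint_operator_def
proof (rule the_equality)
  fix w' assume w': "w' \<in> X \<and> (\<forall>v\<in>D. w' \<bullet> v = u \<bullet> T v)"
  have "closed {v. (w' - w) \<bullet> v = 0}"
    by (rule closed_hyperplane)
  moreover have "D \<subseteq> {v. (w' - w) \<bullet> v = 0}"
    using w w' by (auto simp: inner_diff_left)
  ultimately have "X \<subseteq> {v. (w' - w) \<bullet> v = 0}"
    using dense closure_minimal by blast
  moreover have "w' - w \<in> X"
    using X w w' by (simp add: subspace_diff)
  ultimately show "w' = w"
    by auto
qed (use w in auto)

definition dstar_domain ::
    "(int \<Rightarrow> 'a::real_inner set) \<Rightarrow> (int \<Rightarrow> 'a set) \<Rightarrow> (int \<Rightarrow> 'a \<Rightarrow> 'a) \<Rightarrow> int \<Rightarrow> 'a set" where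
  "dstar_domain W V d k = adjoint_domain (W (k - 1)) (V (k - 1)) (d (k - 1)) (W k)"

definition dstar ::
    "(int \<Rightarrow> 'a::real_inner set) \<Rightarrow> (int \<Rightarrow> 'a set) \<Rightarrow> (int \<Rightarrow> 'a \<Rightarrow> 'a) \<Rightarrow> int \<Rightarrow> 'a \<Rightarrow> 'a" where
  "dstar W V d k = adjoint_operator (W (k - 1)) (V (k - 1)) (d (k - 1))"

definition cocycles_star ::
    "(int \<Rightarrow> 'a::real_inner set) \<Rightarrow> (int \<Rightarrow> 'a set) \<Rightarrow> (int \<Rightarrow> 'a \<Rightarrow> 'a) \<Rightarrow> int \<Rightarrow> 'a set" where
  "cocycles_star W V d k = {u \<in> dstar_domain W V d k. dstar W V d k u = 0}"

definition harmonic ::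
    "(int \<Rightarrow> 'a::real_inner set) \<Rightarrow> (int \<Rightarrow> 'a set) \<Rightarrow> (int \<Rightarrow> 'a \<Rightarrow> 'a) \<Rightarrow> int \<Rightarrow> 'a set" where
  "harmonic W V d k = cocycles V d k \<inter> cocycles_star W V d k"

text \<open>
  The library's \<open>closest_point\<close> needs a Heine--Borel space, so it is not available here.
\<close>

definition orth_proj :: "'a::real_inner set \<Rightarrow> 'a \<Rightarrow> 'a" where
  "orth_proj S x = (THE p. p \<in> S \<and> x - p \<in> S\<^sup>\<bottom>)"

definition Pi_func :: "'a::real_inner \<Rightarrow> 'a \<Rightarrow> real" where
  "Pi_func J v = v \<bullet> J"

text \<open>
  The dimension \<open>dim S\<close> of the library is 0 for infinite-dimensional spaces, so finiteness of
  the dimension is a separate condition.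
\<close>

definition finite_dim :: "'a::real_vector set \<Rightarrow> bool" where
  "finite_dim S \<longleftrightarrow> (\<exists>B. finite B \<and> S \<subseteq> span B)"

text \<open>
  The quotient space \<open>Z/B\<close> is the set of cosets \<open>v +o B\<close> with \<open>v \<in> Z\<close>.  Addition is addition of
  sets; for scalar multiplication \<open>B\<close> is added, because \<open>c\<close> may be 0.
\<close>

definition quotient_space :: "'a::real_vector set \<Rightarrow> 'a set \<Rightarrow> 'a set set" where
  "quotient_space Z B = (\<lambda>v. v +o B) ` Z"

definition quotient_scale :: "'a::real_vector set \<Rightarrow> real \<Rightarrow> 'a set \<Rightarrow> 'a set" where
  "quotient_scale B c X = (\<lambda>x. c *\<^sub>R x) ` X + B"

lemma quotient_add_coset:
  assumes "subspace B"
  shows "(v +o B) + (w +o B) = (v + w) +o B"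
proof -
  have "B + B \<subseteq> B"
    using subspace_add[OF assms] by (auto simp: set_plus_def)
  moreover have "x \<in> B + B" if "x \<in> B" for x
    using set_plus_intro[OF that subspace_0[OF assms]] by simp
  ultimately have "B + B = B"
    by blast
  then show ?thesis
    by (simp add: set_plus_rearrange)
qed

lemma quotient_scale_coset:
  assumes "subspace B"
  shows "quotient_scale B c (v +o B) = (c *\<^sub>R v) +o B"
proof (rule set_eqI, rule iffI)
  fix x assume "x \<in> quotient_scale B c (v +o B)"
  then obtain a b where "a \<in> B" "b \<in> B" "x = c *\<^sub>R (v + a) + b"
    by (auto simp: quotient_scale_def set_plus_def elt_set_plus_def)
  then have "x = c *\<^sub>R v + (c *\<^sub>R a + b)" "c *\<^sub>R a + b \<in> B"
    using assms by (auto simp: algebra_simps subspace_add subspace_scale)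
  then show "x \<in> (c *\<^sub>R v) +o B"
    by (auto simp: elt_set_plus_def)
next
  fix x assume "x \<in> (c *\<^sub>R v) +o B"
  then obtain b where b: "b \<in> B" "x = c *\<^sub>R v + b"
    by (auto simp: elt_set_plus_def)
  have "v \<in> v +o B"
    using subspace_0[OF assms] by (force simp: elt_set_plus_def)
  then show "x \<in> quotient_scale B c (v +o B)"
    using b by (auto simp: quotient_scale_def set_plus_def)
qed

definition quotient_functional :: "'a::real_vector set \<Rightarrow> 'a set \<Rightarrow> ('a set \<Rightarrow> real) \<Rightarrow> bool" where
  "quotient_functional Z B \<Phi> \<longleftrightarrow>
     (\<forall>X\<in>quotient_space Z B. \<forall>Y\<in>quotient_space Z B. \<Phi> (X + Y) = \<Phi> X + \<Phi> Y) \<and>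
     (\<forall>c. \<forall>X\<in>quotient_space Z B. \<Phi> (quotient_scale B c X) = c * \<Phi> X)"

text \<open>
  The elements of the coordinate space of dimension \<open>n\<close> are the functions on \<open>{..<n}\<close>, extended
  by \<open>undefined\<close>, with pointwise operations; \<open>real ^ 'n\<close> would exclude dimension 0.
\<close>

definition coord_space :: "nat \<Rightarrow> (nat \<Rightarrow> real) set" where
  "coord_space n = {..<n} \<rightarrow>\<^sub>E (UNIV :: real set)"

definition isomorphism_onto_coord_space ::
    "'a::real_vector set \<Rightarrow> nat \<Rightarrow> ('a \<Rightarrow> nat \<Rightarrow> real) \<Rightarrow> bool" where
  "isomorphism_onto_coord_space S n F \<longleftrightarrow>
     (\<forall>i<n. linear_map_on S (\<lambda>v. F v i)) \<and> bij_betw F S (coord_space n)"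

definition Pi_vec :: "nat \<Rightarrow> (nat \<Rightarrow> 'a::real_inner) \<Rightarrow> 'a \<Rightarrow> nat \<Rightarrow> real" where
  "Pi_vec n J v = (\<lambda>i\<in>{..<n}. Pi_func (J i) v)"

text \<open>
  Linear independence of the family \<open>x 0, \<dots>, x (n - 1)\<close>; the library notion \<open>independent\<close> is about
  sets, hence the members of the family also have to be distinct.
\<close>

definition independent_family :: "nat \<Rightarrow> (nat \<Rightarrow> 'a::real_vector) \<Rightarrow> bool" where
  "independent_family n x \<longleftrightarrow> inj_on x {..<n} \<and> independent (x ` {..<n})"

end

theory Submission
  imports Defs
begin

text \<open>
  An element of \<open>W k\<close> lies in the kernel of the adjoint iff it is orthogonal to the coboundaries.
  Since the coboundaries form a complete subspace, every cocycle is the sum of a coboundary and a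
  harmonic form, and pairing it with a coclosed \<open>J\<close> only sees the harmonic parts of both.  The
  remaining claims are linear algebra in the finite-dimensional inner product space of harmonic
  forms: a family \<open>x\<close> in it is linearly independent iff every system \<open>v \<bullet> x i = y i\<close> is solvable.
\<close>

section \<open>Orthogonal projections\<close>

lemma orth_proj_eqI:
  assumes S: "subspace S" and p: "p \<in> S" "\<And>y. y \<in> S \<Longrightarrow> (x - p) \<bullet> y = 0"
  shows "orth_proj S x = p"
  unfolding orth_proj_def
proof (rule the_equality)
  show "p \<in> S \<and> x - p \<in> S\<^sup>\<bottom>"
    using p by (auto simp: orthogonal_comp_def orthogonal_def inner_commute)
next
  fix q assume q: "q \<in> S \<and> x - q \<in> S\<^sup>\<bottom>"
  have mem: "p - q \<in> S"
    using S p q by (simp add: subspace_diff)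
  have "(x - q) \<bullet> (p - q) = 0"
    using q mem by (auto simp: orthogonal_comp_def orthogonal_def inner_commute)
  moreover have "(x - p) \<bullet> (p - q) = 0"
    using p(2) mem by blast
  ultimately have "(p - q) \<bullet> (p - q) = 0"
    by (simp add: inner_diff_left)
  then show "q = p"
    by simp
qed

lemma finite_dim_orthogonal_basis:
  fixes S :: "'a::real_inner set"
  assumes "subspace S" "finite_dim S"
  obtains C where "finite C" "span C = S" "pairwise orthogonal C"
proof -
  obtain A where A: "finite A" "S \<subseteq> span A"
    using assms(2) by (auto simp: finite_dim_def)
  obtain T where T: "T \<subseteq> S" "independent T" "S \<subseteq> span T"
    using maximal_independent_subset by blast
  have "finite T"
    using independent_span_bound[OF A(1) T(2)] A(2) T(1) by blast
  then obtain C where "finite C" "span C = span T" "pairwise orthogonal C"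
    using basis_orthogonal by blast
  moreover have "span T = S"
    using T assms(1) by (simp add: span_minimal subset_antisym)
  ultimately show ?thesis
    using that by metis
qed

lemma riesz_finite_dim:
  fixes S :: "'a::real_inner set" and \<phi> :: "'a \<Rightarrow> real"
  assumes S: "subspace S" "finite_dim S" and \<phi>: "linear_map_on S \<phi>"
  obtains w where "w \<in> S" "\<And>v. v \<in> S \<Longrightarrow> \<phi> v = v \<bullet> w"
proof -
  obtain C where C: "finite C" "span C = S" "pairwise orthogonal C"
    using finite_dim_orthogonal_basis[OF S] .
  define w where "w = (\<Sum>c\<in>C. (\<phi> c / (c \<bullet> c)) *\<^sub>R c)"
  have add: "\<phi> (x + y) = \<phi> x + \<phi> y" if "x \<in> S" "y \<in> S" for x y
    using \<phi> that by (simp add: linear_map_on_def)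
  have scale: "\<phi> (r *\<^sub>R x) = r * \<phi> x" if "x \<in> S" for r x
    using \<phi> that by (simp add: linear_map_on_def)
  have zero: "\<phi> 0 = 0"
    using scale[of 0 0] S(1) by (simp add: subspace_0)
  have wS: "w \<in> S"
    unfolding w_def C(2)[symmetric] by (intro span_sum span_scale span_base)
  have onC: "\<phi> c = c \<bullet> w" if "c \<in> C" for c
  proof -
    have "c \<bullet> w = (\<Sum>c'\<in>C. (\<phi> c' / (c' \<bullet> c')) * (c \<bullet> c'))"
      by (simp add: w_def inner_sum_right)
    also have "\<dots> = (\<Sum>c'\<in>C. if c' = c then \<phi> c else 0)"
      using C(3) that zero by (intro sum.cong) (auto simp: pairwise_def orthogonal_def)
    also have "\<dots> = \<phi> c"
      using C(1) that by simp
    finally show ?thesis by simp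
  qed
  have "v \<in> S \<and> \<phi> v = v \<bullet> w" if "v \<in> span C" for v
    using that
  proof (induction rule: span_induct_alt)
    case base
    then show ?case using zero S(1) by (simp add: subspace_0)
  next
    case (step r x y)
    then have "x \<in> S" using C(2) span_base by blast
    then show ?case
      using step S(1) onC add scale
      by (simp add: inner_add_left subspace_add subspace_scale)
  qed
  then show ?thesis
    using that wS C(2) by blast
qed

lemma orth_proj_finite_dim:
  fixes S :: "'a::real_inner set"
  assumes S: "subspace S" "finite_dim S"
  shows "orth_proj S x \<in> S" and "v \<in> S \<Longrightarrow> v \<bullet> orth_proj S x = v \<bullet> x"
proof -
  have "linear_map_on S (\<lambda>v. v \<bullet> x)"
    by (simp add: linear_map_on_def inner_add_left)
  then obtain p where p: "p \<in> S" "\<And>v. v \<in> S \<Longrightarrow> v \<bullet> x = v \<bullet> p"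
    using riesz_finite_dim[OF S] by blast
  then have "orth_proj S x = p"
    by (intro orth_proj_eqI[OF S(1)]) (auto simp: inner_commute[of "x - p"] inner_diff_right)
  then show "orth_proj S x \<in> S" and "v \<in> S \<Longrightarrow> v \<bullet> orth_proj S x = v \<bullet> x"
    using p by auto
qed

lemma complete_subspace_nearest_point:
  fixes S :: "'a::real_inner set"
  assumes S: "subspace S" "complete S"
  obtains p where "p \<in> S" "\<And>y. y \<in> S \<Longrightarrow> norm (x - p) \<le> norm (x - y)"
proof -
  define m where "m = Inf ((\<lambda>s. (norm (x - s))\<^sup>2) ` S)"
  have ne: "S \<noteq> {}"
    using S(1) subspace_0 by blast
  have bdd: "bdd_below ((\<lambda>s. (norm (x - s))\<^sup>2) ` S)"
    by (rule bdd_belowI[of _ 0]) auto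
  have le: "m \<le> (norm (x - s))\<^sup>2" if "s \<in> S" for s
    unfolding m_def using cINF_lower[OF bdd that] .
  have "\<exists>s\<in>S. (norm (x - s))\<^sup>2 < m + inverse (real (Suc n))" for n
  proof -
    have "m < m + inverse (real (Suc n))" by simp
    then show ?thesis
      unfolding m_def using cInf_lessD[of "(\<lambda>s. (norm (x - s))\<^sup>2) ` S"] ne by blast
  qed
  then obtain s where s: "\<And>n. s n \<in> S" "\<And>n. (norm (x - s n))\<^sup>2 < m + inverse (real (Suc n))"
    by metis
  have par: "(norm (s i - s j))\<^sup>2 \<le> 2 * inverse (real (Suc i)) + 2 * inverse (real (Suc j))" for i j
  proof -
    have "(1/2) *\<^sub>R (s i + s j) \<in> S"
      using S(1) s(1) by (simp add: subspace_add subspace_scale)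
    then have "m \<le> (norm (x - (1/2) *\<^sub>R (s i + s j)))\<^sup>2"
      by (rule le)
    moreover have "(norm (s i - s j))\<^sup>2 = 2 * (norm (x - s i))\<^sup>2 + 2 * (norm (x - s j))\<^sup>2
        - 4 * (norm (x - (1/2) *\<^sub>R (s i + s j)))\<^sup>2"
    proof -
      define u w where "u = x - s i" and "w = x - s j"
      have "s i - s j = w - u" "x - (1/2) *\<^sub>R (s i + s j) = (1/2) *\<^sub>R (u + w)"
        by (simp_all add: u_def w_def algebra_simps flip: scaleR_add_left)
      then show ?thesis
        unfolding u_def[symmetric] w_def[symmetric]
        by (simp add: power_divide)
          (simp add: power2_norm_eq_inner inner_diff inner_add inner_commute[of w u])
    qed
    ultimately show ?thesis
      using s(2)[of i] s(2)[of j] by linarith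
  qed
  have "Cauchy s"
  proof (rule metric_CauchyI)
    fix e :: real assume e: "0 < e"
    obtain N where N: "inverse (real (Suc N)) < e\<^sup>2 / 4"
      using reals_Archimedean[of "e\<^sup>2 / 4"] e by auto
    have "dist (s i) (s j) < e" if "N \<le> i" "N \<le> j" for i j
    proof -
      have "inverse (real (Suc i)) \<le> inverse (real (Suc N))"
        "inverse (real (Suc j)) \<le> inverse (real (Suc N))"
        using that by (auto intro!: le_imp_inverse_le)
      then have "(norm (s i - s j))\<^sup>2 < e\<^sup>2"
        using par[of i j] N by linarith
      then show ?thesis
        using e by (simp add: dist_norm power_less_imp_less_base)
    qed
    then show "\<exists>M. \<forall>i\<ge>M. \<forall>j\<ge>M. dist (s i) (s j) < e"
      by blast
  qed
  then obtain p where p: "p \<in> S" "s \<longlonglongrightarrow> p"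
    using S(2) s(1) unfolding complete_def by blast
  have "(\<lambda>n. (norm (x - s n))\<^sup>2) \<longlonglongrightarrow> (norm (x - p))\<^sup>2"
    by (intro tendsto_intros p)
  moreover have "(\<lambda>n. m + inverse (real (Suc n))) \<longlonglongrightarrow> m + 0"
    by (intro tendsto_intros LIMSEQ_inverse_real_of_nat)
  ultimately have "(norm (x - p))\<^sup>2 \<le> m + 0"
    using s(2) by (intro LIMSEQ_le) (auto intro: less_imp_le)
  then have "(norm (x - p))\<^sup>2 \<le> (norm (x - y))\<^sup>2" if "y \<in> S" for y
    using le[OF that] by linarith
  then have "norm (x - p) \<le> norm (x - y)" if "y \<in> S" for y
    using that power2_le_imp_le norm_ge_zero by blast
  then show ?thesis
    using that p(1) by blast
qed

lemma complete_subspace_orthogonal_decomposition: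
  fixes S :: "'a::real_inner set"
  assumes S: "subspace S" "complete S"
  obtains p where "p \<in> S" "\<And>y. y \<in> S \<Longrightarrow> (x - p) \<bullet> y = 0"
proof -
  obtain p where p: "p \<in> S" "\<And>y. y \<in> S \<Longrightarrow> norm (x - p) \<le> norm (x - y)"
    using complete_subspace_nearest_point[OF S] by blast
  have "(x - p) \<bullet> y = 0" if "y \<in> S" for y
  proof (cases "y = 0")
    case False
    define t where "t = ((x - p) \<bullet> y) / (y \<bullet> y)"
    have t: "t * (y \<bullet> y) = (x - p) \<bullet> y"
      using False by (simp add: t_def)
    have expand: "(norm (a - t *\<^sub>R y))\<^sup>2 = (norm a)\<^sup>2 - 2 * t * (a \<bullet> y) + t * (t * (y \<bullet> y))" for a
      unfolding power2_norm_eq_inner by (simp add: inner_diff inner_commute[of y a] right_diff_distrib)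
    have "p + t *\<^sub>R y \<in> S"
      using S(1) p(1) that by (simp add: subspace_add subspace_scale)
    then have "(norm (x - p))\<^sup>2 \<le> (norm ((x - p) - t *\<^sub>R y))\<^sup>2"
      using p(2)[of "p + t *\<^sub>R y"] by (simp add: diff_diff_eq)
    also have "\<dots> = (norm (x - p))\<^sup>2 - 2 * t * ((x - p) \<bullet> y) + t * (t * (y \<bullet> y))"
      by (rule expand)
    finally have "t * (t * (y \<bullet> y)) \<le> 0"
      by (simp add: t)
    then have "t\<^sup>2 * (y \<bullet> y) \<le> 0"
      by (simp add: power2_eq_square mult.assoc)
    moreover have "y \<bullet> y > 0"
      using False by simp
    ultimately have "t = 0"
      by (auto simp: mult_le_0_iff)
    then show ?thesis
      using t by simp
  qed simp
  then show ?thesis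
    using that p(1) by blast
qed

section \<open>Independent families and coordinates\<close>

lemma independent_spans_of_card_eq_dim:
  assumes S: "subspace S" "finite_dim S"
    and A: "independent A" "A \<subseteq> S" "card A = dim S"
  shows "span A = S"
proof -
  obtain C where C: "finite C" "S \<subseteq> span C"
    using S(2) by (auto simp: finite_dim_def)
  obtain T where T: "A \<subseteq> T" "T \<subseteq> S" "independent T" "S \<subseteq> span T"
    using maximal_independent_subset_extend[OF A(2,1)] by blast
  have "finite T"
    using independent_span_bound[OF C(1) T(3)] C(2) T(2) by blast
  moreover have "card T = dim S"
    using basis_card_eq_dim[OF T(2,4,3)] .
  ultimately have "A = T"
    using T(1) A(3) by (simp add: card_subset_eq)
  then show ?thesis
    using T S(1) by (simp add: span_minimal subset_antisym)
qed

lemma inner_family_isomorphism_iff: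
  fixes x :: "nat \<Rightarrow> 'a::real_inner"
  assumes S: "subspace S" "finite_dim S" and x: "\<And>i. i < dim S \<Longrightarrow> x i \<in> S"
  shows "isomorphism_onto_coord_space S (dim S) (\<lambda>v. \<lambda>i\<in>{..<dim S}. v \<bullet> x i)
    \<longleftrightarrow> independent_family (dim S) x"
    (is "isomorphism_onto_coord_space S ?n ?F \<longleftrightarrow> _")
proof
  assume "isomorphism_onto_coord_space S ?n ?F"
  then have onto: "?F ` S = coord_space ?n"
    by (simp add: isomorphism_onto_coord_space_def bij_betw_def)
  have "\<exists>v\<in>S. \<forall>j<?n. v \<bullet> x j = (if j = i then 1 else 0)" for i
  proof -
    have "(\<lambda>j\<in>{..<?n}. if j = i then 1 else 0) \<in> ?F ` S"
      unfolding onto by (simp add: coord_space_def)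
    then obtain v where v: "v \<in> S" "(\<lambda>j\<in>{..<?n}. if j = i then 1 else 0) = ?F v"
      by blast
    have "v \<bullet> x j = (if j = i then 1 else 0)" if "j < ?n" for j
      using fun_cong[OF v(2), of j] that by simp
    then show ?thesis using v(1) by blast
  qed
  then obtain v where v: "\<And>i j. j < ?n \<Longrightarrow> v i \<bullet> x j = (if j = i then 1 else 0)"
    by metis
  have inj: "inj_on x {..<?n}"
  proof (rule inj_onI)
    fix i j assume ij: "i \<in> {..<?n}" "j \<in> {..<?n}" "x i = x j"
    then have "v i \<bullet> x i = 1" "v i \<bullet> x i = (if j = i then 1 else 0)"
      using v[of i i] v[of j i] by simp_all
    then show "i = j"
      by (metis zero_neq_one)
  qed
  have "independent (x ` {..<?n})"
  proof (unfold dependent_def, safe)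
    fix i assume i: "i < ?n" and mem: "x i \<in> span (x ` {..<?n} - {x i})"
    have "v i \<bullet> y = 0" if "y \<in> span (x ` {..<?n} - {x i})" for y
      using that
    proof (induction rule: span_induct_alt)
      case (step c y z)
      then show ?case
        using v[of _ i] by (auto simp: inner_add_right split: if_splits)
    qed simp
    then show False
      using v[of i i] i mem by force
  qed
  with inj show "independent_family ?n x"
    by (simp add: independent_family_def)
next
  assume "independent_family ?n x"
  then have inj: "inj_on x {..<?n}" and ind: "independent (x ` {..<?n})"
    by (auto simp: independent_family_def)
  have span: "span (x ` {..<?n}) = S"
    using independent_spans_of_card_eq_dim[OF S ind] x by (auto simp: card_image[OF inj])
  have "inj_on ?F S"
  proof (rule inj_onI)
    fix u v assume uv: "u \<in> S" "v \<in> S" "?F u = ?F v"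
    have eq: "(u - v) \<bullet> x i = 0" if "i < ?n" for i
      using fun_cong[OF uv(3), of i] that by (simp add: inner_diff_left)
    have "(u - v) \<bullet> y = 0" if "y \<in> span (x ` {..<?n})" for y
      using that by (induction rule: span_induct_alt) (auto simp: inner_add_right eq)
    moreover have "u - v \<in> S"
      using S(1) uv by (simp add: subspace_diff)
    ultimately have "(u - v) \<bullet> (u - v) = 0"
      using span by blast
    then show "u = v" by simp
  qed
  moreover have "?F ` S = coord_space ?n"
  proof
    show "?F ` S \<subseteq> coord_space ?n"
      by (auto simp: coord_space_def split: if_splits)
    show "coord_space ?n \<subseteq> ?F ` S"
    proof
      fix y :: "nat \<Rightarrow> real" assume y: "y \<in> coord_space ?n"
      obtain g where g: "linear g"
        "\<forall>z\<in>x ` {..<?n}. g z = y (the_inv_into {..<?n} x z)"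
        using linear_independent_extend[OF ind, of "\<lambda>z. y (the_inv_into {..<?n} x z)"] by auto
      have "linear_map_on S g"
        using g(1) by (simp add: linear_map_on_def linear_add linear_scale)
      then obtain w where w: "w \<in> S" "\<And>v. v \<in> S \<Longrightarrow> g v = v \<bullet> w"
        using riesz_finite_dim[OF S] by blast
      have "w \<bullet> x i = y i" if "i < ?n" for i
        using g(2) w(2)[OF x[OF that]] that
        by (simp add: the_inv_into_f_f[OF inj] inner_commute)
      then have "?F w = y"
        using y by (auto simp: coord_space_def PiE_def extensional_def)
      then show "y \<in> ?F ` S"
        using w(1) by blast
    qed
  qed
  ultimately show "isomorphism_onto_coord_space S ?n ?F"
    by (simp add: isomorphism_onto_coord_space_def bij_betw_def linear_map_on_def inner_add_left)
qed

lemma linear_descends_to_quotient: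
  fixes f :: "'a::real_vector \<Rightarrow> real"
  assumes f: "linear f" and B: "subspace B" and f0: "\<And>v. v \<in> B \<Longrightarrow> f v = 0"
  obtains \<Phi> where "quotient_functional Z B \<Phi>" "\<And>v. \<Phi> (v +o B) = f v"
proof -
  define \<Phi> where "\<Phi> X = f (SOME v. v \<in> X)" for X
  have \<Phi>: "\<Phi> (v +o B) = f v" for v
  proof -
    have "v \<in> v +o B"
      using subspace_0[OF B] by (force simp: elt_set_plus_def)
    then have "(SOME w. w \<in> v +o B) \<in> v +o B"
      by (rule someI)
    then show ?thesis
      using f f0 by (auto simp: \<Phi>_def elt_set_plus_def linear_add)
  qed
  have "quotient_functional Z B \<Phi>"
    using f by (auto simp: quotient_functional_def quotient_space_def \<Phi> quotient_add_coset[OF B]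
        quotient_scale_coset[OF B] linear_add linear_scale)
  then show ?thesis
    using that \<Phi> by blast
qed

section \<open>Closed Hilbert complexes\<close>

context hilbert_complex
begin

lemma V_subset_W: "V k \<subseteq> W k"
  using dense_V[of k] closure_subset by metis

lemma d_add: "x \<in> V k \<Longrightarrow> y \<in> V k \<Longrightarrow> d k (x + y) = d k x + d k y"
  using linear_d[of k] by (simp add: linear_map_on_def)

lemma d_scale: "x \<in> V k \<Longrightarrow> d k (c *\<^sub>R x) = c *\<^sub>R d k x"
  using linear_d[of k] by (simp add: linear_map_on_def)

lemma d_0: "d k 0 = 0"
  using d_scale[of 0 k 0] subspace_V[of k] by (simp add: subspace_0)

lemma subspace_cocycles: "subspace (cocycles V d k)"
  using subspace_V[of k]
  by (auto simp: subspace_def cocycles_def d_0 d_add d_scale)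

lemma subspace_coboundaries: "subspace (coboundaries V d k)"
  unfolding coboundaries_def
proof (rule subspaceI)
  let ?V = "V (k - 1)" and ?d = "d (k - 1)"
  show "0 \<in> ?d ` ?V"
    using d_0 subspace_0[OF subspace_V] by (metis image_eqI)
  show "x + y \<in> ?d ` ?V" if "x \<in> ?d ` ?V" "y \<in> ?d ` ?V" for x y
    using that subspace_add[OF subspace_V] by (auto simp flip: d_add)
  show "c *\<^sub>R x \<in> ?d ` ?V" if "x \<in> ?d ` ?V" for c x
    using that subspace_scale[OF subspace_V] by (auto simp flip: d_scale)
qed

lemma coboundaries_subset_cocycles: "coboundaries V d k \<subseteq> cocycles V d k"
  using d_maps[of _ "k - 1"] d_d[of _ "k - 1"] by (auto simp: coboundaries_def cocycles_def)

lemma cocycles_star_iff: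
  "u \<in> cocycles_star W V d k \<longleftrightarrow> u \<in> W k \<and> (\<forall>v\<in>coboundaries V d k. v \<bullet> u = 0)"
proof
  assume "u \<in> cocycles_star W V d k"
  then obtain w where w: "u \<in> W k" "w \<in> W (k - 1)" "\<forall>v\<in>V (k - 1). w \<bullet> v = u \<bullet> d (k - 1) v"
    and 0: "dstar W V d k u = 0"
    by (auto simp: cocycles_star_def dstar_domain_def adjoint_domain_def)
  have "dstar W V d k u = w"
    unfolding dstar_def using w by (intro adjoint_operator_eqI subspace_W dense_V) auto
  then show "u \<in> W k \<and> (\<forall>v\<in>coboundaries V d k. v \<bullet> u = 0)"
    using w 0 by (auto simp: coboundaries_def inner_commute)
next
  assume u: "u \<in> W k \<and> (\<forall>v\<in>coboundaries V d k. v \<bullet> u = 0)"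
  have 0: "0 \<in> W (k - 1)"
    using subspace_W by (rule subspace_0)
  have eq: "0 \<bullet> v = u \<bullet> d (k - 1) v" if "v \<in> V (k - 1)" for v
    using u that by (simp add: coboundaries_def inner_commute)
  have "dstar W V d k u = 0"
    unfolding dstar_def by (intro adjoint_operator_eqI subspace_W dense_V 0 eq)
  then show "u \<in> cocycles_star W V d k"
    using u 0 eq unfolding cocycles_star_def dstar_domain_def adjoint_domain_def by blast
qed

lemma harmonic_iff:
  "u \<in> harmonic W V d k \<longleftrightarrow> u \<in> cocycles V d k \<and> (\<forall>v\<in>coboundaries V d k. v \<bullet> u = 0)"
  using V_subset_W[of k] by (auto simp: harmonic_def cocycles_star_iff cocycles_def)

lemma subspace_harmonic: "subspace (harmonic W V d k)"
  using subspace_cocycles[of k] by (auto simp: subspace_def harmonic_iff inner_add_right)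

end

context closed_hilbert_complex
begin

lemma complete_coboundaries: "complete (coboundaries V d k)"
proof -
  have "coboundaries V d k \<subseteq> W k"
    using coboundaries_subset_cocycles[of k] V_subset_W[of k] by (auto simp: cocycles_def)
  then show ?thesis
    using complete_Int_closed[OF complete_W[of k] closed_coboundaries[of k]]
    by (simp add: Int_absorb1)
qed

lemma cocycle_diff_orth_proj_harmonic:
  assumes v: "v \<in> cocycles V d k"
  shows "v - orth_proj (harmonic W V d k) v \<in> coboundaries V d k"
proof -
  obtain q where q: "q \<in> coboundaries V d k" "\<And>y. y \<in> coboundaries V d k \<Longrightarrow> (v - q) \<bullet> y = 0"
    using complete_subspace_orthogonal_decomposition[OF subspace_coboundaries complete_coboundaries]
    by blast
  have "v - q \<in> cocycles V d k"
    using q(1) v coboundaries_subset_cocycles subspace_cocycles by (blast intro: subspace_diff)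
  then have "v - q \<in> harmonic W V d k"
    using q(2) by (simp add: harmonic_iff inner_commute)
  then have "orth_proj (harmonic W V d k) v = v - q"
    using q(1) by (intro orth_proj_eqI subspace_harmonic) (auto simp: harmonic_iff)
  then show ?thesis
    using q(1) by simp
qed

end

theorem theorem3p1:
  fixes W V :: "int \<Rightarrow> 'a::real_inner set"
    and d :: "int \<Rightarrow> 'a \<Rightarrow> 'a"
    and k :: int
  assumes "closed_hilbert_complex W V d"
    and "finite_dim (harmonic W V d k)"
  defines "Z \<equiv> cocycles V d k"
    and "B \<equiv> coboundaries V d k"
    and "Zs \<equiv> cocycles_star W V d k"
    and "H \<equiv> harmonic W V d k"
    and "P \<equiv> orth_proj (harmonic W V d k)"
    and "b \<equiv> dim (harmonic W V d k)"
  shows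
    "(\<forall>J\<in>Zs.
        (\<forall>v\<in>B. Pi_func J v = 0) \<and>
        (\<exists>\<Phi>. quotient_functional Z B \<Phi> \<and> (\<forall>v\<in>Z. \<Phi> (v +o B) = Pi_func J v))) \<and>
     (\<forall>J\<in>Zs. \<forall>v\<in>Z. Pi_func J v = P v \<bullet> P J) \<and>
     (\<forall>J\<in>Zs. \<forall>J'\<in>Zs. P J = P J' \<longrightarrow> (\<forall>v\<in>Z. Pi_func J v = Pi_func J' v)) \<and>
     (\<forall>\<phi> :: 'a \<Rightarrow> real. linear_map_on H \<phi> \<longrightarrow> (\<exists>J\<in>Zs. \<forall>v\<in>H. \<phi> v = v \<bullet> J)) \<and>
     (\<forall>J :: nat \<Rightarrow> 'a. (\<forall>i<b. J i \<in> Zs) \<longrightarrow>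
        (isomorphism_onto_coord_space H b (Pi_vec b J) \<longleftrightarrow> independent_family b (\<lambda>i. P (J i))))"
proof -
  interpret closed_hilbert_complex W V d by fact
  have H: "subspace H" "finite_dim H"
    using assms(2) subspace_harmonic by (auto simp: H_def)
  have PH: "P x \<in> H" and P_inner: "v \<in> H \<Longrightarrow> v \<bullet> P x = v \<bullet> x" for x v
    using orth_proj_finite_dim[OF H] by (auto simp: P_def H_def)
  have HZs: "H \<subseteq> Zs"
    by (auto simp: H_def Zs_def harmonic_def)
  have vanish: "v \<bullet> J = 0" if "J \<in> Zs" "v \<in> B" for J v
    using that by (simp add: Zs_def B_def cocycles_star_iff)
  have quotient: "\<exists>\<Phi>. quotient_functional Z B \<Phi> \<and> (\<forall>v\<in>Z. \<Phi> (v +o B) = Pi_func J v)"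
    if "J \<in> Zs" for J
  proof -
    have "linear (Pi_func J)"
      by (simp add: linear_iff Pi_func_def inner_add_left)
    moreover have "subspace B"
      by (simp add: B_def subspace_coboundaries)
    ultimately show ?thesis
      using linear_descends_to_quotient[of "Pi_func J" B Z] vanish[OF that]
      by (metis Pi_func_def)
  qed
  have formula: "Pi_func J v = P v \<bullet> P J" if "J \<in> Zs" "v \<in> Z" for J v
  proof -
    have "v - P v \<in> B"
      using cocycle_diff_orth_proj_harmonic that(2) by (simp add: P_def Z_def B_def)
    then have "v \<bullet> J = P v \<bullet> J"
      using vanish[OF that(1)] by (fastforce simp: inner_diff_left)
    then show ?thesis
      by (simp add: Pi_func_def P_inner PH)
  qed
  have riesz: "\<exists>J\<in>Zs. \<forall>v\<in>H. \<phi> v = v \<bullet> J" if "linear_map_on H \<phi>" for \<phi> :: "'a \<Rightarrow> real"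
    using riesz_finite_dim[OF H that] HZs by (metis subsetD)
  have iso: "isomorphism_onto_coord_space H b (Pi_vec b J) \<longleftrightarrow> independent_family b (\<lambda>i. P (J i))"
    for J
  proof -
    have b: "b = dim H"
      by (simp add: b_def H_def)
    have eq: "Pi_vec b J v = (\<lambda>i\<in>{..<b}. v \<bullet> P (J i))" if "v \<in> H" for v
      using that by (simp add: Pi_vec_def Pi_func_def P_inner)
    have "isomorphism_onto_coord_space H b (Pi_vec b J)
        \<longleftrightarrow> isomorphism_onto_coord_space H b (\<lambda>v. \<lambda>i\<in>{..<b}. v \<bullet> P (J i))"
      using H(1) by (simp add: isomorphism_onto_coord_space_def linear_map_on_def eq
          subspace_add subspace_scale cong: bij_betw_cong)
    then show ?thesis
      using inner_family_isomorphism_iff[OF H, of "\<lambda>i. P (J i)"] PH b by simp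
  qed
  show ?thesis
    using vanish quotient formula riesz iso by (auto simp: Pi_func_def)
qed

end
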